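(* For all $j,k\in\{1,\dots,n\}$ with $k<j$, the expected value of $\tilde a_{j,h_j(k)}$ equals $a_{j,k}$.
   Context: $G=(V,E)$ is a fixed simple graph on $v_1,\dots,v_n$, with $a_{j,k}=1$ iff $\{v_j,v_k\}\in E$ (else $0$), and $d_j=|\{k<j:a_{j,k}=1\}|$ (the "low degree"). Parameters: $\varepsilon_0,\varepsilon_1>0$, integer $s\ge1$, $p$ the smallest prime larger than $n$, $m=\lceil p/s\rceil\ge 2$, $\varepsilon'=\ln(1+s(e^{\varepsilon_1}-1))$. User $v_j$ partitions the users, by a public random hash function $h_j$, into $m$ groups padded with dummy non-neighbours to size $s$, draws one uniformly random representative in each group, and records its adjacency bit (set to $0$ if the representative has index larger than $j$ or is a dummy). For $k<j$, $a_{j,h_j(k)}$ denotes the bit recorded for the group containing $v_k$. In the paper's analysis, over the random grouping and the choice of representative, $$\Pr[a_{j,h_j(k)}=1]=\begin{cases}\frac1s+\frac{s-1}{s}\cdot\frac{d_j-1}{ms-1}& \text{if }a_{j,k}=1,\\ \frac{s-1}{s}\cdot\frac{d_j}{ms-1}&\text{if }a_{j,k}=0.\end{cases}$$ The bit $a'_{j,h_j(k)}$ is obtained from $a_{j,h_j(k)}$ by randomized response: it equals $a_{j,h_j(k)}$ with probability $\frac{e^{\varepsilon'}}{1+e^{\varepsilon'}}$ and its complement with probability $\frac1{1+e^{\varepsilon'}}$. Independently of all this, $\tilde d_j=d_j+L_j$ with $L_j$ Laplace noise of scale $1/\varepsilon_0$ (mean $0$). Finally $$\omega_j=\frac{e^{\varepsilon'}+1}{e^{\varepsilon'}-1}\cdot\frac{ms-1}{m-1},\quad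 \tilde\sigma_j=\frac{s-1}{ms-s}\tilde d_j+\frac1{e^{\varepsilon'}-1}\cdot\frac{ms-1}{m-1},\quad \tilde a_{j,h_j(k)}=\omega_j a'_{j,h_j(k)}-\tilde\sigma_j .$$ *)

theory Defs
  imports "HOL-Probability.Probability" "HOL-Computational_Algebra.Primes"
begin

text \<open>A simple graph on the users \<open>{1..n}\<close> is given by its set of edges, which are
  two-element sets of users.\<close>

definition simple_graph :: "nat \<Rightarrow> nat set set \<Rightarrow> bool" where
  "simple_graph n E \<longleftrightarrow> (\<forall>e\<in>E. e \<subseteq> {1..n} \<and> card e = 2)"

definition adj :: "nat set set \<Rightarrow> nat \<Rightarrow> nat \<Rightarrow> nat" where
  "adj E j k = (if {j, k} \<in> E then 1 else 0)"

definition low_degree :: "nat set set \<Rightarrow> nat \<Rightarrow> nat" where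
  "low_degree E j = card {k \<in> {1..<j}. adj E j k = 1}"

definition next_prime :: "nat \<Rightarrow> nat" where
  "next_prime n = (LEAST p. prime p \<and> n < p)"

definition num_groups :: "nat \<Rightarrow> nat \<Rightarrow> nat" where
  "num_groups n s = nat \<lceil>real (next_prime n) / real s\<rceil>"

definition eps' :: "nat \<Rightarrow> real \<Rightarrow> real" where
  "eps' s \<epsilon>1 = ln (1 + real s * (exp \<epsilon>1 - 1))"

text \<open>A hash function assigns every user to one of \<open>m\<close> groups. It is admissible if no
  group exceeds the size \<open>s\<close> to which the groups are then padded with dummies.\<close>

definition admissible_hash :: "nat \<Rightarrow> nat \<Rightarrow> nat \<Rightarrow> (nat \<Rightarrow> nat) \<Rightarrow> bool" where
  "admissible_hash n m s h \<longleftrightarrow>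
     (\<forall>i\<in>{1..n}. h i < m) \<and> (\<forall>g<m. card {i \<in> {1..n}. h i = g} \<le> s)"

datatype member = User nat | Dummy nat

definition padded_group :: "nat \<Rightarrow> nat \<Rightarrow> (nat \<Rightarrow> nat) \<Rightarrow> nat \<Rightarrow> member set" where
  "padded_group n s h g =
     User ` {i \<in> {1..n}. h i = g} \<union> Dummy ` {..<s - card {i \<in> {1..n}. h i = g}}"

definition bit_of_member :: "nat set set \<Rightarrow> nat \<Rightarrow> member \<Rightarrow> bool" where
  "bit_of_member E j x =
     (case x of User i \<Rightarrow> (if i > j then False else adj E j i = 1) | Dummy _ \<Rightarrow> False)"

text \<open>The joint law of the hash function (drawn from \<open>H\<close>) and of the bits that user \<open>j\<close>
  records, indexed by the groups. \<open>Pi_pmf\<close> draws the representatives of the groups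
  independently; its default value is irrelevant since only groups below \<open>m\<close> are accessed.\<close>

definition recorded_bits ::
  "nat \<Rightarrow> nat set set \<Rightarrow> nat \<Rightarrow> nat \<Rightarrow> (nat \<Rightarrow> nat) pmf \<Rightarrow> nat \<Rightarrow> ((nat \<Rightarrow> nat) \<times> (nat \<Rightarrow> bool)) pmf"
  where
  "recorded_bits n E m s H j =
     bind_pmf H (\<lambda>h.
       map_pmf (\<lambda>r. (h, \<lambda>g. bit_of_member E j (r g)))
         (Pi_pmf {..<m} (Dummy 0) (\<lambda>g. pmf_of_set (padded_group n s h g))))"

definition randomized_response :: "real \<Rightarrow> bool \<Rightarrow> bool pmf" where
  "randomized_response \<epsilon> b =
     map_pmf (\<lambda>keep. if keep then b else \<not> b) (bernoulli_pmf (exp \<epsilon> / (1 + exp \<epsilon>)))"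

definition noisy_bits ::
  "nat \<Rightarrow> nat set set \<Rightarrow> nat \<Rightarrow> nat \<Rightarrow> (nat \<Rightarrow> nat) pmf \<Rightarrow> real \<Rightarrow> nat \<Rightarrow>
     ((nat \<Rightarrow> nat) \<times> (nat \<Rightarrow> bool)) pmf"
  where
  "noisy_bits n E m s H \<epsilon> j =
     bind_pmf (recorded_bits n E m s H j) (\<lambda>(h, b).
       map_pmf (\<lambda>b'. (h, b')) (Pi_pmf {..<m} False (\<lambda>g. randomized_response \<epsilon> (b g))))"

definition laplace :: "real \<Rightarrow> real measure" where
  "laplace b = density lborel (\<lambda>x. ennreal (exp (- \<bar>x\<bar> / b) / (2 * b)))"

definition mechanism ::
  "nat \<Rightarrow> nat set set \<Rightarrow> nat \<Rightarrow> nat \<Rightarrow> (nat \<Rightarrow> nat) pmf \<Rightarrow> real \<Rightarrow> real \<Rightarrow> nat \<Rightarrow>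
     (((nat \<Rightarrow> nat) \<times> (nat \<Rightarrow> bool)) \<times> real) measure"
  where
  "mechanism n E m s H \<epsilon>0 \<epsilon> j =
     measure_pmf (noisy_bits n E m s H \<epsilon> j) \<Otimes>\<^sub>M laplace (1 / \<epsilon>0)"

definition omega :: "nat \<Rightarrow> nat \<Rightarrow> real \<Rightarrow> real" where
  "omega m s \<epsilon> = (exp \<epsilon> + 1) / (exp \<epsilon> - 1) * ((real m * real s - 1) / (real m - 1))"

definition sigma_tilde :: "nat \<Rightarrow> nat \<Rightarrow> real \<Rightarrow> real \<Rightarrow> real" where
  "sigma_tilde m s \<epsilon> d =
     (real s - 1) / (real m * real s - real s) * d
     + 1 / (exp \<epsilon> - 1) * ((real m * real s - 1) / (real m - 1))"

text \<open>The estimator, as a function of the outcome \<open>((h, b'), L)\<close> of the mechanism.\<close>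

definition a_tilde ::
  "nat set set \<Rightarrow> nat \<Rightarrow> nat \<Rightarrow> real \<Rightarrow> nat \<Rightarrow> nat \<Rightarrow> ((nat \<Rightarrow> nat) \<times> (nat \<Rightarrow> bool)) \<times> real \<Rightarrow> real"
  where
  "a_tilde E m s \<epsilon> j k = (\<lambda>((h, b'), L).
     omega m s \<epsilon> * of_bool (b' (h k)) - sigma_tilde m s \<epsilon> (real (low_degree E j) + L))"

end

(* Conditioning on the recorded bit, randomized response turns a success probability q into
   (1 + (P - 1) q) / (1 + P) with P = exp \<epsilon> > 1; multiplying by omega and subtracting the constant
   part of sigma_tilde inverts this affine map and leaves (m s - 1) / (m - 1) * q. The remaining
   degree term of sigma_tilde cancels the contribution to q of the neighbours that share the
   group, and the Laplace noise enters linearly with mean 0. *)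

theory Submission imports Defs begin

text \<open>On the positive half line the Laplace density is half the exponential density of rate
  \<open>1 / b\<close>, so each moment is half an exponential one. Order 0 gives the total mass of
  the noise, order 1 its mean.\<close>

lemma has_bochner_integral_exp_abs_half:
  fixes b :: real
  assumes b: "b > 0"
  shows "has_bochner_integral lborel
    (\<lambda>x. indicator {0..} x *\<^sub>R (exp (- \<bar>x\<bar> / b) / (2 * b) * x ^ i)) (fact i * b ^ i / 2)"
proof -
  have "has_bochner_integral lborel (\<lambda>x. exponential_density (1 / b) x * x ^ i) (fact i * b ^ i)"
  proof (rule has_bochner_integral_nn_integral)
    show "(\<integral>\<^sup>+ x. ennreal (exponential_density (1 / b) x * x ^ i) \<partial>lborel) = ennreal (fact i * b ^ i)"
      using nn_integral_erlang_ith_moment[of "1 / b" 0 i] b by (simp add: power_one_over)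
    show "AE x in lborel. 0 \<le> exponential_density (1 / b) x * x ^ i"
      using b by (auto simp: exponential_density_def)
  qed (use b in auto)
  from has_bochner_integral_mult_right[OF this, of "1 / 2"] show ?thesis
    by (rule has_bochner_integral_cong[THEN iffD1, rotated -1])
       (use b in \<open>auto simp: exponential_density_def indicator_def\<close>)
qed

lemma prob_space_laplace:
  assumes "b > 0"
  shows "prob_space (laplace b)"
proof
  have "has_bochner_integral lborel (\<lambda>x. exp (- \<bar>x\<bar> / b) / (2 * b)) 1"
    using has_bochner_integral_even_function[OF has_bochner_integral_exp_abs_half[OF assms, of 0]]
    by simp
  then have "(\<integral>\<^sup>+x. ennreal (exp (- \<bar>x\<bar> / b) / (2 * b)) \<partial>lborel) = 1"
    using assms by (subst nn_integral_eq_integral) (auto simp: has_bochner_integral_iff)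
  then show "emeasure (laplace b) (space (laplace b)) = 1"
    by (simp add: laplace_def emeasure_density)
qed

lemma has_bochner_integral_laplace_mean:
  assumes "b > 0"
  shows "has_bochner_integral (laplace b) (\<lambda>x. x) 0"
proof -
  \<comment> \<open>The first moment \<open>b / 2\<close> on the half line provides integrability;
    since the integrand is odd, the two halves cancel.\<close>
  have "has_bochner_integral lborel (\<lambda>x. (exp (- \<bar>x\<bar> / b) / (2 * b)) *\<^sub>R x) 0"
    using has_bochner_integral_odd_function[OF has_bochner_integral_exp_abs_half[OF assms, of 1]]
    by simp
  then show ?thesis
    unfolding laplace_def using assms
    by (intro has_bochner_integral_density) auto
qed

lemma pmf_bind_randomized_response:
  "pmf (bind_pmf M (randomized_response \<epsilon>)) True =
     (1 + (exp \<epsilon> - 1) * pmf M True) / (1 + exp \<epsilon>)"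
proof -
  have p: "exp \<epsilon> / (1 + exp \<epsilon>) \<in> {0..1}"
    by (simp add: divide_le_eq add_pos_pos)
  have keep: "(\<lambda>keep. if keep then True else \<not> True) = (\<lambda>x. x)"
    and flip: "(\<lambda>keep. if keep then False else \<not> False) = Not"
    by auto
  have "pmf (randomized_response \<epsilon> True) True = exp \<epsilon> / (1 + exp \<epsilon>)"
    using p unfolding randomized_response_def keep by simp
  moreover have "pmf (randomized_response \<epsilon> False) True = 1 / (1 + exp \<epsilon>)"
    using p unfolding randomized_response_def flip
    \<comment> \<open>Since \<open>Not\<close> is injective, the mass of \<open>True\<close> after
      flipping is the mass of \<open>False\<close> before it.\<close>
    using pmf_map_inj'[of Not "bernoulli_pmf (exp \<epsilon> / (1 + exp \<epsilon>))" False]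
      add_pos_pos[OF zero_less_one exp_gt_zero[of \<epsilon>]]
    by (simp add: inj_def divide_simps)
  moreover have "pmf M False = 1 - pmf M True"
    using pmf_False_conv_True by blast
  ultimately show ?thesis
    by (simp add: pmf_bind integral_measure_pmf_real[of UNIV] UNIV_bool algebra_simps
        flip: add_divide_distrib diff_divide_distrib)
qed

text \<open>Only coordinate \<open>h k\<close> is read, and the marginal of a product at an index of
  its index set is the factor there. The bound \<open>h k < m\<close> keeps the index away from the
  default value \<open>False\<close> of \<open>Pi_pmf\<close>.\<close>

lemma map_noisy_bits:
  assumes "\<And>h. h \<in> set_pmf H \<Longrightarrow> h k < m"
  shows "map_pmf (\<lambda>(h, b'). b' (h k)) (noisy_bits n E m s H \<epsilon> j) =
    bind_pmf (map_pmf (\<lambda>(h, b). b (h k)) (recorded_bits n E m s H j)) (randomized_response \<epsilon>)"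
proof -
  have "map_pmf (\<lambda>b'. b' (h k)) (Pi_pmf {..<m} False (\<lambda>g. randomized_response \<epsilon> (b g))) =
      randomized_response \<epsilon> (b (h k))"
    if "(h, b) \<in> set_pmf (recorded_bits n E m s H j)" for h b
  proof -
    have "h \<in> set_pmf H"
      using that by (auto simp: recorded_bits_def)
    then show ?thesis
      using assms by (simp add: Pi_pmf_component)
  qed
  then show ?thesis
    unfolding noisy_bits_def map_bind_pmf bind_map_pmf
    by (intro bind_pmf_cong refl) (auto simp: pmf.map_comp o_def)
qed

text \<open>Shaped to rewrite the unfolded \<open>omega\<close> and \<open>sigma_tilde\<close>:
  \<open>c\<close> is the factor (m s - 1) / (m - 1) and \<open>t\<close> the degree term. Rescaling
  alone gives \<open>c * (1 / (P - 1) + q)\<close>, and the constant part of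
  \<open>sigma_tilde\<close> removes the offset.\<close>

lemma debias_randomized_response:
  fixes P q :: real
  assumes "P > 1"
  shows "(P + 1) / (P - 1) * c * ((1 + (P - 1) * q) / (1 + P)) - (t + 1 / (P - 1) * c) = c * q - t"
proof -
  have "(P + 1) / (P - 1) * ((1 + (P - 1) * q) / (1 + P)) = 1 / (P - 1) + q"
    using assms by (simp add: divide_simps) (simp add: algebra_simps)
  then have "(P + 1) / (P - 1) * c * ((1 + (P - 1) * q) / (1 + P)) = c * (1 / (P - 1) + q)"
    by (metis mult.assoc mult.commute)
  then show ?thesis
    unfolding distrib_left by simp
qed

lemma debiased_neighbour_share:
  fixes m s d :: real
  assumes "m > 1" "s \<ge> 1"
  shows "(m * s - 1) / (m - 1) * ((s - 1) / s * (d / (m * s - 1))) = (s - 1) / (m * s - s) * d"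
proof -
  \<comment> \<open>Makes \<open>m * s - 1\<close> nonzero, so that it cancels.\<close>
  have "m * s \<ge> m * 1" using assms by (intro mult_left_mono) auto
  then have "m * s - 1 > 0" using assms by linarith
  moreover have eq: "m * s - s = s * (m - 1)" by algebra
  ultimately show ?thesis using assms unfolding eq by simp
qed

text \<open>The term \<open>1 / s\<close> comes from the neighbour being its own group's
  representative. As m s - 1 = (m s - s) + (s - 1), it yields 1 plus the share of one neighbour,
  which raises \<open>d - 1\<close> back to \<open>d\<close>.\<close>

lemma debiased_neighbour_share_plus_own:
  fixes m s d :: real
  assumes "m > 1" "s \<ge> 1"
  shows "(m * s - 1) / (m - 1) * (1 / s + (s - 1) / s * ((d - 1) / (m * s - 1))) =
    1 + (s - 1) / (m * s - s) * d"
proof -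
  have "(m * s - 1) / (m - 1) * (1 / s) = 1 + (s - 1) / (m * s - s)"
  proof -
    have eq: "m * s - s = s * (m - 1)" by algebra
    show ?thesis using assms unfolding eq by (simp add: divide_simps) (simp add: algebra_simps)
  qed
  moreover have "(s - 1) / (m * s - s) + (s - 1) / (m * s - s) * (d - 1) = (s - 1) / (m * s - s) * d"
    unfolding right_diff_distrib by simp
  ultimately show ?thesis
    unfolding distrib_left debiased_neighbour_share[OF assms] by linarith
qed

text \<open>Change of variables along a measure-preserving map; it lifts integrals from the factors
  of the mechanism to the product.\<close>

lemma has_bochner_integral_distr_eq:
  fixes g :: "'b \<Rightarrow> real"
  assumes "f \<in> measurable M N" "distr M N f = N" "has_bochner_integral N g c"
  shows "has_bochner_integral M (\<lambda>x. g (f x)) c"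
proof -
  have "g \<in> borel_measurable N" using assms(3) by (auto simp: has_bochner_integral_iff)
  then show ?thesis
    using integrable_distr_eq[OF assms(1), of g] integral_distr[OF assms(1), of g] assms(2,3)
    by (simp add: has_bochner_integral_iff)
qed

lemma (in prob_space) distr_pair_snd:
  assumes "sigma_finite_measure N"
  shows "distr (M \<Otimes>\<^sub>M N) N snd = N"
proof (rule measure_eqI)
  interpret N: sigma_finite_measure N by fact
  fix A assume "A \<in> sets (distr (M \<Otimes>\<^sub>M N) N snd)"
  then have A: "A \<in> sets N" by simp
  then have "emeasure (distr (M \<Otimes>\<^sub>M N) N snd) A = emeasure (M \<Otimes>\<^sub>M N) (space M \<times> A)"
    by (auto simp: emeasure_distr space_pair_measure dest: sets.sets_into_space
             intro!: arg_cong[where f="emeasure (M \<Otimes>\<^sub>M N)"])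
  with A show "emeasure (distr (M \<Otimes>\<^sub>M N) N snd) A = emeasure N A"
    by (simp add: N.emeasure_pair_measure_Times emeasure_space_1)
qed simp

text \<open>The estimator is affine in the noisy bit and the noise, so linearity reduces it to the
  two marginals. The law of the recorded bits enters only through \<open>q\<close>.\<close>

lemma has_bochner_integral_mechanism:
  assumes "\<epsilon>0 > 0"
    and "\<And>h. h \<in> set_pmf H \<Longrightarrow> h k < m"
    and q: "measure_pmf.prob (recorded_bits n E m s H j) {(h, b). b (h k)} = q"
  shows "has_bochner_integral (mechanism n E m s H \<epsilon>0 \<epsilon> j) (a_tilde E m s \<epsilon> j k)
     (omega m s \<epsilon> * ((1 + (exp \<epsilon> - 1) * q) / (1 + exp \<epsilon>)) - sigma_tilde m s \<epsilon> (low_degree E j))"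
proof -
  let ?N = "noisy_bits n E m s H \<epsilon> j" and ?L = "laplace (1 / \<epsilon>0)"
  let ?bit = "\<lambda>(h, b'). b' (h k) :: bool"
  interpret L: prob_space ?L
    using assms(1) by (intro prob_space_laplace) simp
  interpret P: prob_space "measure_pmf ?N \<Otimes>\<^sub>M ?L"
    by (intro prob_space_pair measure_pmf.prob_space_axioms L.prob_space_axioms)
  have "pmf (map_pmf ?bit (recorded_bits n E m s H j)) True = q"
    unfolding q[symmetric] pmf_map by (intro arg_cong[where f="measure_pmf.prob _"]) auto
  then have "pmf (map_pmf ?bit ?N) True = (1 + (exp \<epsilon> - 1) * q) / (1 + exp \<epsilon>)"
    using assms(2) by (simp add: map_noisy_bits pmf_bind_randomized_response)
  moreover have "measure_pmf.expectation ?N (\<lambda>x. of_bool (?bit x)) = pmf (map_pmf ?bit ?N) True"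
    unfolding integral_map_pmf[where g = ?bit and f = "of_bool :: bool \<Rightarrow> real", symmetric]
    by (simp add: integral_measure_pmf_real[of UNIV] UNIV_bool del: integral_map_pmf)
  moreover have "integrable (measure_pmf ?N) (\<lambda>x. of_bool (?bit x) :: real)"
    by (intro measure_pmf.integrable_const_bound[where B=1]) auto
  ultimately have bit: "has_bochner_integral (measure_pmf ?N) (\<lambda>x. of_bool (?bit x))
      ((1 + (exp \<epsilon> - 1) * q) / (1 + exp \<epsilon>))"
    by (simp add: has_bochner_integral_iff)
  have 1: "has_bochner_integral (measure_pmf ?N \<Otimes>\<^sub>M ?L) (\<lambda>x. of_bool (?bit (fst x)))
      ((1 + (exp \<epsilon> - 1) * q) / (1 + exp \<epsilon>))"
    by (rule has_bochner_integral_distr_eq[OF _ L.distr_pair_fst bit]) simp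
  have 2: "has_bochner_integral (measure_pmf ?N \<Otimes>\<^sub>M ?L) snd 0"
    by (rule has_bochner_integral_distr_eq[OF _ measure_pmf.distr_pair_snd
          has_bochner_integral_laplace_mean]) (use assms(1) L.sigma_finite_measure_axioms in auto)
  have 3: "has_bochner_integral (measure_pmf ?N \<Otimes>\<^sub>M ?L) (\<lambda>x. c) c" for c :: real
    using P.prob_space by (simp add: has_bochner_integral_iff)
  \<comment> \<open>\<open>sigma_tilde\<close> is affine in its degree argument: the true degree
    gives a constant, and the noise \<open>snd x\<close> is left with the slope as its
    factor.\<close>
  have "a_tilde E m s \<epsilon> j k = (\<lambda>x. omega m s \<epsilon> * of_bool (?bit (fst x))
      - (sigma_tilde m s \<epsilon> (low_degree E j) + (real s - 1) / (real m * real s - real s) * snd x))"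
    by (auto simp: a_tilde_def sigma_tilde_def ring_distribs)
  moreover have "has_bochner_integral (measure_pmf ?N \<Otimes>\<^sub>M ?L) \<dots>
     (omega m s \<epsilon> * ((1 + (exp \<epsilon> - 1) * q) / (1 + exp \<epsilon>))
      - (sigma_tilde m s \<epsilon> (low_degree E j) + (real s - 1) / (real m * real s - real s) * 0))"
    by (intro has_bochner_integral_diff has_bochner_integral_add has_bochner_integral_mult_right 1 2 3)
  ultimately show ?thesis by (simp add: mechanism_def)
qed

text \<open>Integrability is claimed as well because a non-integrable function has Bochner integral
  0 by convention, which would satisfy the equation for non-adjacent pairs.\<close>

theorem theorem3:
  fixes n s m :: nat and E :: "nat set set" and \<epsilon>0 \<epsilon>1 \<epsilon> :: real
    and H :: "nat \<Rightarrow> (nat \<Rightarrow> nat) pmf"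
  assumes graph: "simple_graph n E"
    and eps0: "\<epsilon>0 > 0" and eps1: "\<epsilon>1 > 0" and s: "s \<ge> 1"
    and m_def: "m = num_groups n s" and m: "m \<ge> 2"
    and eps_def: "\<epsilon> = eps' s \<epsilon>1"
    and hash: "\<And>j h. j \<in> {1..n} \<Longrightarrow> h \<in> set_pmf (H j) \<Longrightarrow> admissible_hash n m s h"
    and law: "\<And>j k. j \<in> {1..n} \<Longrightarrow> k \<in> {1..n} \<Longrightarrow> k < j \<Longrightarrow>
      measure_pmf.prob (recorded_bits n E m s (H j) j) {(h, b). b (h k)} =
        (if adj E j k = 1
         then 1 / real s
           + (real s - 1) / real s * ((real (low_degree E j) - 1) / (real m * real s - 1))
         else (real s - 1) / real s * (real (low_degree E j) / (real m * real s - 1)))"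
  shows "\<forall>j\<in>{1..n}. \<forall>k\<in>{1..n}. k < j \<longrightarrow>
    integrable (mechanism n E m s (H j) \<epsilon>0 \<epsilon> j) (a_tilde E m s \<epsilon> j k) \<and>
    (\<integral>x. a_tilde E m s \<epsilon> j k x \<partial>mechanism n E m s (H j) \<epsilon>0 \<epsilon> j) = real (adj E j k)"
proof (intro ballI impI)
  fix j k assume j: "j \<in> {1..n}" and k: "k \<in> {1..n}" and "k < j"
  define q where "q = measure_pmf.prob (recorded_bits n E m s (H j) j) {(h, b). b (h k)}"
  have ms: "real m > 1" "real s \<ge> 1" using m s by auto
  \<comment> \<open>By the choice of \<open>eps'\<close>, this quantity is exp \<epsilon> - 1, the
    denominator in \<open>omega\<close> and \<open>sigma_tilde\<close>.\<close>
  have "0 < real s * (exp \<epsilon>1 - 1)" using eps1 s by simp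
  then have exp: "exp \<epsilon> > 1" by (simp add: eps_def eps'_def)
  have "h k < m" if "h \<in> set_pmf (H j)" for h
    using hash[OF j that] k by (auto simp: admissible_hash_def)
  then have "has_bochner_integral (mechanism n E m s (H j) \<epsilon>0 \<epsilon> j) (a_tilde E m s \<epsilon> j k)
     (omega m s \<epsilon> * ((1 + (exp \<epsilon> - 1) * q) / (1 + exp \<epsilon>)) - sigma_tilde m s \<epsilon> (low_degree E j))"
    by (intro has_bochner_integral_mechanism eps0 q_def[symmetric])
  then have "has_bochner_integral (mechanism n E m s (H j) \<epsilon>0 \<epsilon> j) (a_tilde E m s \<epsilon> j k)
     ((real m * real s - 1) / (real m - 1) * q
       - (real s - 1) / (real m * real s - real s) * low_degree E j)"
    unfolding omega_def sigma_tilde_def debias_randomized_response[OF exp] .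
  \<comment> \<open>In both cases the debiased probability contains the full degree term, which
    cancels; an edge leaves the extra 1. The restricted simplification keeps the fractions in the
    form of the two algebraic lemmas.\<close>
  moreover have "(real m * real s - 1) / (real m - 1) * q
       - (real s - 1) / (real m * real s - real s) * low_degree E j = real (adj E j k)"
    using debiased_neighbour_share[OF ms, of "low_degree E j"]
      debiased_neighbour_share_plus_own[OF ms, of "low_degree E j"]
    unfolding q_def law[OF j k \<open>k < j\<close>] adj_def
    by (cases "{j, k} \<in> E") (simp_all only: simp_thms if_True if_False zero_neq_one of_nat_0 of_nat_1
        diff_self add_diff_cancel_right')
  ultimately show "integrable (mechanism n E m s (H j) \<epsilon>0 \<epsilon> j) (a_tilde E m s \<epsilon> j k) \<and>
    (\<integral>x. a_tilde E m s \<epsilon> j k x \<partial>mechanism n E m s (H j) \<epsilon>0 \<epsilon> j) = real (adj E j k)"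
    by (simp add: has_bochner_integral_iff)
qed

end
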